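(* Assume $S=\{(x_i,y_i)\}_{i=1}^n$ is drawn i.i.d. from $\mathcal{D}_\kappa$ with large enough $\kappa\in(0,\infty)$. If $n=\exp(\mathcal{O}(\kappa))$, then with probability at least $0.99$ both of the following hold: the data $\{(x_i,y_i)\}_{i=1}^n$ is linearly separable (there is $w\in\mathbb{R}^d$ with $(2y_i-1)w^\top x_i>0$ for all $i$), and $$\mathrm{sim}(\bar w_S,\Sigma^{-1}\mu)<\frac{1+\mathrm{sim}(\mu,\Sigma^{-1}\mu)}{2},$$ where $\bar w_S$ is the $\ell_2$ max margin solution $$\bar w_S=\operatorname*{arg\,min}_{w\in\mathbb{R}^d}\ \|w\|^2\quad\text{subject to}\quad (2y_i-1)\,w^\top x_i\ge 1\ \text{ for all } i=1,\dots,n.$$ Here "large enough $\kappa$" and "$n=\exp(\mathcal{O}(\kappa))$" mean: there exist constants $c>0$ and $\kappa_0>0$, depending only on $d,\mu,\Sigma$, such that the conclusion holds for all $\kappa\in[\kappa_0,\infty)$ and all integers $1\le n\le\exp(c\kappa)$.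
   Context: Fix $d\ge 1$, a nonzero vector $\mu\in\mathbb{R}^d$ and a (symmetric) positive definite matrix $\Sigma\in\mathbb{R}^{d\times d}$ with $\|\mu\|^2=\|\Sigma\|$ ($\ell_2$ norm for vectors, spectral norm for matrices). For $\kappa\in(0,\infty)$, $\mathcal{D}_\kappa$ is the distribution of $(x,y)\in\mathbb{R}^d\times\{0,1\}$ with $y$ uniform on $\{0,1\}$, $x\mid y=1\sim N(\mu,\kappa^{-1}\Sigma)$ and $x\mid y=0\sim N(-\mu,\kappa^{-1}\Sigma)$. For nonzero $u,v\in\mathbb{R}^d$, $\mathrm{sim}(u,v)=\frac{u^\top v}{\|u\|\|v\|}$.
   Formalization: The dimension is assumed to be d ≥ 2 instead of d ≥ 1; for d = 1 the claim is false, since the right-hand side equals 1 and the similarity is 1 unless every (2y_i−1)x_i has sign opposite to μ, an event of probability below 1/2. *)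

theory Defs
  imports "HOL-Probability.Probability"
begin

definition pos_def :: "real ^ 'd ^ 'd \<Rightarrow> bool" where
  "pos_def A \<longleftrightarrow> transpose A = A \<and> (\<forall>v. v \<noteq> 0 \<longrightarrow> 0 < v \<bullet> (A *v v))"

(* the spectral norm, i.e. the operator norm induced by the Euclidean norm *)
definition spectral_norm :: "real ^ 'd ^ 'd \<Rightarrow> real" where
  "spectral_norm A = onorm ((*v) A)"

definition sim :: "real ^ 'd \<Rightarrow> real ^ 'd \<Rightarrow> real" where
  "sim u v = (u \<bullet> v) / (norm u * norm v)"

(* The Gaussian N(m, A); meaningful for positive definite A, where it is given by its density. *)
definition mv_normal :: "real ^ 'd \<Rightarrow> real ^ 'd ^ 'd \<Rightarrow> (real ^ 'd) measure" where
  "mv_normal m A = density lborel (\<lambda>x. ennreal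
     (exp (- ((x - m) \<bullet> (matrix_inv A *v (x - m))) / 2) / sqrt ((2 * pi) ^ CARD('d) * det A)))"

(* The law of (x, y): draw the label y, then x from the conditional law of x given y. *)
definition mixture ::
    "real ^ 'd \<Rightarrow> real ^ 'd ^ 'd \<Rightarrow> real \<Rightarrow> ((real ^ 'd) \<times> nat) measure" where
  "mixture \<mu> A \<kappa> =
     measure_pmf (pmf_of_set {0, 1}) \<bind> (\<lambda>y.
       distr (mv_normal (if y = 1 then \<mu> else - \<mu>) ((1 / \<kappa>) *\<^sub>R A))
         (borel \<Otimes>\<^sub>M count_space UNIV) (\<lambda>x. (x, y)))"

definition iid_sample ::
    "real ^ 'd \<Rightarrow> real ^ 'd ^ 'd \<Rightarrow> real \<Rightarrow> nat \<Rightarrow> (nat \<Rightarrow> (real ^ 'd) \<times> nat) measure" where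
  "iid_sample \<mu> A \<kappa> n = Pi\<^sub>M {1..n} (\<lambda>_. mixture \<mu> A \<kappa>)"

definition signed_margin :: "real ^ 'd \<Rightarrow> (real ^ 'd) \<times> nat \<Rightarrow> real" where
  "signed_margin w p = (2 * real (snd p) - 1) * (w \<bullet> fst p)"

definition linearly_separable :: "nat \<Rightarrow> (nat \<Rightarrow> (real ^ 'd) \<times> nat) \<Rightarrow> bool" where
  "linearly_separable n S \<longleftrightarrow> (\<exists>w. \<forall>i\<in>{1..n}. 0 < signed_margin w (S i))"

(* For separable data the minimiser exists and is unique; otherwise the constraint set is empty
   and the value is unspecified. *)
definition max_margin :: "nat \<Rightarrow> (nat \<Rightarrow> (real ^ 'd) \<times> nat) \<Rightarrow> real ^ 'd" where
  "max_margin n S =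
     arg_min (\<lambda>w. (norm w)\<^sup>2) (\<lambda>w. \<forall>i\<in>{1..n}. 1 \<le> signed_margin w (S i))"

(* The theorem about max_margin needs dimension at least 2. In dimension 1 the vector
   matrix_inv A *v \<mu> is a positive multiple of \<mu>, so (1 + sim \<mu> (matrix_inv A *v \<mu>)) / 2 = 1,
   while on linearly separable data sim (max_margin n S) (matrix_inv A *v \<mu>) is also 1 unless
   every (2 y_i - 1) x_i points away from \<mu>, an event of probability below 1/2. *)

end

theory Submission
  imports Defs
begin

text \<open>
  Write \<open>z i = (2 y i - 1) x i\<close>; given either label this is \<open>N(\<mu>, \<Sigma> / \<kappa>)\<close>. A Gaussian tail bound and
  independence put all \<open>z i\<close> within \<open>\<epsilon>\<close> of \<open>\<mu>\<close> with high probability as long as \<open>n \<le> exp (c \<kappa>)\<close>. Then \<open>\<mu>\<close>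
  itself separates the data, and the maximum-margin direction has similarity at least \<open>1 - 2 \<epsilon> / \<parallel>\<mu>\<parallel>\<close>
  to \<open>\<mu>\<close>; so if \<open>sim \<mu> (\<Sigma>\<^sup>-\<^sup>1 \<mu>) < 1\<close>, a small \<open>\<epsilon>\<close> gives the claim. In the remaining case \<open>\<Sigma>\<^sup>-\<^sup>1 \<mu>\<close> is
  parallel to \<open>\<mu>\<close>, and the claim only says that the maximum-margin vector is not a multiple of \<open>\<mu>\<close>.
  This holds almost surely in dimension at least two: no \<open>z i\<close> is parallel to \<open>\<mu>\<close>, and the numbers
  \<open>\<mu> \<bullet> z i\<close> are distinct.
\<close>

section \<open>Linear changes of variables and the standard Gaussian\<close>

text \<open>Every linear map is a composition of elementary ones, and determinant and volume factor
  are both multiplicative. It remains to compare them for singular maps, stretches, swaps and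
  shears.\<close>

lemma measure_linear_image_cart:
  fixes f :: "real ^ 'n \<Rightarrow> real ^ 'n"
  assumes "linear f" "S \<in> lmeasurable"
  shows "f ` S \<in> lmeasurable \<and> measure lebesgue (f ` S) = \<bar>det (matrix f)\<bar> * measure lebesgue S"
proof -
  let ?P = "\<lambda>f::real ^ 'n \<Rightarrow> real ^ 'n. \<forall>S\<in>lmeasurable. f ` S \<in> lmeasurable \<and>
    measure lebesgue (f ` S) = \<bar>det (matrix f)\<bar> * measure lebesgue S"
  have "?P f"
  proof (rule induct_linear_elementary[OF \<open>linear f\<close>])
    fix f g :: "real ^ 'n \<Rightarrow> real ^ 'n"
    assume lin: "linear f" "linear g" and P: "?P f" "?P g"
    have "(f \<circ> g) ` S = f ` (g ` S)" for S
      by (simp add: image_comp)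
    moreover have "matrix (f \<circ> g) = matrix f ** matrix g"
      using lin by (simp add: matrix_compose)
    ultimately show "?P (f \<circ> g)"
      using P by (simp only: det_mul abs_mult mult.assoc) simp
  next
    fix f :: "real ^ 'n \<Rightarrow> real ^ 'n" and i
    assume f: "linear f" and "\<And>x. f x $ i = 0"
    \<comment> \<open>A vanishing coordinate makes the map singular: image volume and determinant
      are both zero.\<close>
    then have "\<not> surj f"
      by (metis one_neq_zero surjE vec_component)
    then have "\<not> inj f"
      using f linear_injective_imp_surjective by blast
    then have "negligible (f ` S)" "det (matrix f) = 0" for S
      using f negligible_linear_singular_image det_nz_iff_inj by blast+
    then show "?P f"
      by (simp add: negligible_iff_measure)
  next
    fix c :: "'n \<Rightarrow> real"
    show "?P (\<lambda>x. \<chi> i. c i * x $ i)"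
      by (simp add: measurable_stretch measure_stretch matrix_def axis_def det_diagonal)
  next
    fix m n :: 'n
    assume "m \<noteq> n"
    let ?t = "Transposition.transpose m n"
    let ?h = "\<lambda>x::real ^ 'n. \<chi> i. x $ ?t i"
    have lin: "linear ?h"
      by (rule linearI) (simp_all add: vec_eq_iff)
    have tp: "?t permutes UNIV"
      by (simp add: permutes_swap_id)
    \<comment> \<open>The swap is its own inverse, so it carries boxes onto boxes with the side
      lengths permuted.\<close>
    have img: "?h ` cbox a b = cbox (?h a) (?h b)" for a b
    proof -
      have "x \<in> ?h ` cbox a b" if "x \<in> cbox (?h a) (?h b)" for x
      proof
        show "x = ?h (?h x)" by (simp add: vec_eq_iff)
        show "?h x \<in> cbox a b"
          using that by (simp add: mem_box_cart) (metis transpose_involutory)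
      qed
      then show ?thesis by (auto simp: mem_box_cart)
    qed
    have im: "measure lebesgue (?h ` cbox a b) = 1 * measure lebesgue (cbox a b)" for a b
    proof (cases "cbox a b = {}")
      case False
      then have "cbox (?h a) (?h b) \<noteq> {}"
        using img by (metis image_is_empty)
      then show ?thesis
        using False prod.permute[OF tp, of "\<lambda>i. b $ i - a $ i"]
        by (simp add: img content_cbox_cart o_def)
    qed simp
    have "matrix ?h = (\<chi> i. (mat 1 :: real ^ 'n ^ 'n) $ ?t i)"
      by (simp add: vec_eq_iff matrix_def mat_def axis_def)
    then have det: "\<bar>det (matrix ?h)\<bar> = 1"
      by (simp add: det_permute_rows[OF tp] sign_swap_id \<open>m \<noteq> n\<close>)
    show "?P ?h"
    proof
      fix S :: "(real ^ 'n) set"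
      assume S: "S \<in> lmeasurable"
      have "?h ` S \<in> lmeasurable \<and> 1 * measure lebesgue S = measure lebesgue (?h ` S)"
        by (rule measure_linear_sufficient[OF lin S im])
      then show "?h ` S \<in> lmeasurable \<and>
          measure lebesgue (?h ` S) = \<bar>det (matrix ?h)\<bar> * measure lebesgue S"
        by (elim conjE) (simp only: det)
    qed
  next
    fix m n :: 'n
    assume mn: "m \<noteq> n"
    let ?h = "\<lambda>x::real ^ 'n. \<chi> i. if i = m then x $ m + x $ n else x $ i"
    have lin: "linear ?h"
      by (rule linearI) (simp_all add: vec_eq_iff algebra_simps)
    have im: "measure lebesgue (?h ` cbox a b) = 1 * measure lebesgue (cbox a b)" for a b
    proof (cases "cbox a b = {}")
      case False
      \<comment> \<open>The box is moved to have its lower corner at the origin, where the shear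
        volume formula is applied; translation preserves volume.\<close>
      have box: "cbox a b = (+) a ` cbox 0 (b - a)"
        using cbox_translation[of a 0 "b - a"] by simp
      have "?h ` cbox a b = (+) (?h a) ` (?h ` cbox 0 (b - a))"
        unfolding box image_image using linear_add[OF lin] by (intro image_cong) auto
      moreover have "cbox 0 (b - a) \<noteq> {}"
        using False box by force
      ultimately show ?thesis
        using mn measure_shear_interval[of m n 0 "b - a"] box
        by (simp add: measure_translation)
    qed simp
    have "matrix ?h = (\<chi> k. if k = m then row m (mat 1) + 1 *s row n (mat 1) else row k (mat 1))"
      by (simp add: vec_eq_iff matrix_def mat_def axis_def row_def)
    then have det: "\<bar>det (matrix ?h)\<bar> = 1"
      using det_row_operation[OF mn, of "mat 1 :: real ^ 'n ^ 'n" 1] by simp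
    show "?P ?h"
    proof
      fix S :: "(real ^ 'n) set"
      assume S: "S \<in> lmeasurable"
      have "?h ` S \<in> lmeasurable \<and> 1 * measure lebesgue S = measure lebesgue (?h ` S)"
        by (rule measure_linear_sufficient[OF lin S im])
      then show "?h ` S \<in> lmeasurable \<and>
          measure lebesgue (?h ` S) = \<bar>det (matrix ?h)\<bar> * measure lebesgue S"
        by (elim conjE) (simp only: det)
    qed
  qed
  then show ?thesis
    using assms by blast
qed

text \<open>Lebesgue measure is determined by its values on boxes. The preimage of a box under
  \<open>A\<close> is its image under the inverse, and the weight cancels the resulting volume
  factor. This is the rule for substituting \<open>A *v u\<close> in integrals.\<close>

lemma lborel_linear_cart:
  fixes A :: "real ^ 'n ^ 'n"
  assumes "invertible A"
  shows "lborel = density (distr lborel borel ((*v) A)) (\<lambda>_. ennreal \<bar>det A\<bar>)"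
proof (rule lborel_eqI)
  obtain B where AB: "A ** B = mat 1" "B ** A = mat 1"
    using assms by (auto simp: invertible_def)
  have meas[measurable]: "(*v) A \<in> borel_measurable borel"
    by (intro borel_measurable_continuous_onI linear_continuous_on) simp
  have vimage: "(*v) A -` S = (*v) B ` S" for S
  proof (intro set_eqI iffI)
    fix x assume "x \<in> (*v) A -` S"
    moreover have "x = B *v (A *v x)"
      by (simp add: matrix_vector_mul_assoc AB)
    ultimately show "x \<in> (*v) B ` S" by blast
  qed (auto simp: matrix_vector_mul_assoc AB)
  have dets: "\<bar>det A\<bar> * \<bar>det B\<bar> = 1"
    using det_mul[of A B] AB by (simp flip: abs_mult)
  fix l u :: "real ^ 'n"
  assume lu: "\<And>b. b \<in> Basis \<Longrightarrow> l \<bullet> b \<le> u \<bullet> b"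
  have "box l u \<in> lmeasurable"
    by simp
  then have img: "(*v) B ` box l u \<in> lmeasurable"
    "measure lebesgue ((*v) B ` box l u) = \<bar>det B\<bar> * measure lebesgue (box l u)"
    using measure_linear_image_cart[of "(*v) B"] by (simp_all add: matrix_of_matrix_vector_mul)
  have sets: "(*v) B ` box l u \<in> sets borel"
    using measurable_sets[OF meas, of "box l u"] by (simp add: vimage)
  have "emeasure lborel ((*v) B ` box l u) = ennreal (\<bar>det B\<bar> * (\<Prod>b\<in>Basis. (u - l) \<bullet> b))"
  proof -
    have "emeasure lborel ((*v) B ` box l u) = emeasure lebesgue ((*v) B ` box l u)"
      using sets by simp
    also have "\<dots> = ennreal (measure lebesgue ((*v) B ` box l u))"
      using img(1) by (simp add: emeasure_eq_measure2 fmeasurableD2)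
    finally show ?thesis
      using img(2) lu by (simp add: measure_lborel_box_eq)
  qed
  then show "emeasure (density (distr lborel borel ((*v) A)) (\<lambda>_. ennreal \<bar>det A\<bar>)) (box l u)
      = (\<Prod>b\<in>Basis. (u - l) \<bullet> b)"
    using dets lu
    by (simp add: emeasure_density nn_integral_cmult_indicator emeasure_distr vimage
        flip: ennreal_mult' mult.assoc)
qed simp

text \<open>The integrand is the product over the coordinates of one-dimensional standard normal
  densities, so the integral factorises.\<close>

lemma nn_integral_std_gaussian_cart:
  "(\<integral>\<^sup>+x. ennreal (exp (- (x \<bullet> x) / 2) / sqrt ((2 * pi) ^ CARD('n))) \<partial>(lborel :: (real ^ 'n) measure)) = 1"
proof -
  have "exp (- (x \<bullet> x) / 2) / sqrt ((2 * pi) ^ CARD('n)) = (\<Prod>b\<in>Basis. std_normal_density (x \<bullet> b))"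
    for x :: "real ^ 'n"
  proof -
    have "x \<bullet> x = (\<Sum>b\<in>Basis. (x \<bullet> b)\<^sup>2)"
      by (subst euclidean_inner) (simp add: power2_eq_square)
    moreover have "sqrt ((2 * pi) ^ CARD('n)) = sqrt (2 * pi) ^ card (Basis :: (real ^ 'n) set)"
      by (simp only: real_sqrt_power DIM_cart DIM_real mult_1_right)
    ultimately show ?thesis
      by (simp add: std_normal_density_def prod_dividef exp_sum[symmetric] sum_negf sum_divide_distrib
          power_one_over prod.distrib)
  qed
  moreover have "(\<integral>\<^sup>+x. std_normal_density x \<partial>lborel) = 1"
    using prob_space.emeasure_space_1[OF prob_space_normal_density[of 1 0]]
    by (simp add: emeasure_density)
  ultimately show ?thesis
    using nn_integral_lborel_prod[of "\<lambda>_::real ^ 'n. ennreal \<circ> std_normal_density"]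
    by (simp add: prod_ennreal)
qed

lemma pos_def_inner_commute:
  assumes "pos_def A"
  shows "x \<bullet> (A *v y) = y \<bullet> (A *v x)"
  using assms by (metis dot_lmul_matrix inner_commute pos_def_def transpose_matrix_vector)

text \<open>Gram-Schmidt for the inner product of \<open>A\<close>: an \<open>A\<close>-orthonormal set of maximal size is a basis,
  and its elements are the columns of \<open>P\<close>.\<close>
lemma pos_def_congruent_identity:
  fixes A :: "real ^ 'n ^ 'n"
  assumes A: "pos_def A"
  shows "\<exists>P :: real ^ 'n ^ 'n. transpose P ** A ** P = mat 1"
proof -
  define q where "q x y = x \<bullet> (A *v y)" for x y
  have sym: "q x y = q y x" for x y
    using pos_def_inner_commute[OF A] by (simp add: q_def)
  have bil: "q (x - y) z = q x z - q y z" "q x (y - z) = q x y - q x z"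
    "q (c *\<^sub>R x) z = c * q x z" "q x (c *\<^sub>R z) = c * q x z" for x y z c
    by (simp_all add: q_def inner_diff_left matrix_vector_mult_diff_distrib inner_diff_right
        matrix_vector_mult_scaleR)
  have q_sum: "q (\<Sum>b\<in>B. f b *\<^sub>R b) y = (\<Sum>b\<in>B. f b * q b y)" for f B y
    by (simp add: q_def inner_sum_left)
  have pos: "0 < q x x" if "x \<noteq> 0" for x
    using A that by (simp add: pos_def_def q_def)
  define ON where "ON B \<longleftrightarrow> finite B \<and> (\<forall>x\<in>B. \<forall>y\<in>B. q x y = of_bool (x = y))" for B
  have indep: "independent B" if "ON B" for B
    unfolding dependent_finite[OF that[unfolded ON_def, THEN conjunct1]]
  proof (rule notI, elim exE conjE bexE)
    fix u v assume v: "v \<in> B" "u v \<noteq> 0" and "(\<Sum>b\<in>B. u b *\<^sub>R b) = 0"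
    then have "(\<Sum>b\<in>B. u b * q b v) = 0"
      by (metis q_sum q_def inner_zero_left)
    moreover have "(\<Sum>b\<in>B. u b * q b v) = (\<Sum>b\<in>B. if b = v then u b else 0)"
      using that v by (intro sum.cong) (auto simp: ON_def)
    ultimately show False
      using that v by (simp add: ON_def)
  qed
  \<comment> \<open>A largest such set exists: the empty set qualifies, and independence bounds the
    cardinality by the dimension.\<close>
  have "ON {}"
    by (simp add: ON_def)
  moreover have "card B \<le> CARD('n)" if "ON B" for B
    using independent_bound[OF indep[OF that]] by simp
  ultimately have "\<exists>B. ON B \<and> (\<forall>B'. ON B' \<longrightarrow> card B' \<le> card B)"
    by (intro ex_has_greatest_nat[where k="{}" and b="Suc CARD('n)"]) (simp_all add: less_Suc_eq_le)
  then obtain B where B: "ON B" "\<And>B'. ON B' \<Longrightarrow> card B' \<le> card B"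
    by blast
  have fin: "finite B"
    using B by (simp add: ON_def)
  have "card B = CARD('n)"
  proof (rule ccontr)
    assume "card B \<noteq> CARD('n)"
    then have "dim B < DIM(real ^ 'n)"
      using dim_eq_card_independent[OF indep] independent_bound[OF indep] B(1) by fastforce
    then obtain v where v: "v \<notin> span B"
      using dim_eq_full by (metis UNIV_eq_I nless_le)
    \<comment> \<open>The residual of \<open>v\<close> after \<open>q\<close>-orthogonal projection
      onto the span of \<open>B\<close>. It is nonzero, so normalising it enlarges \<open>B\<close>
      and contradicts maximality.\<close>
    define w where "w = v - (\<Sum>b\<in>B. q v b *\<^sub>R b)"
    have "(\<Sum>b\<in>B. q v b *\<^sub>R b) \<in> span B"
      by (intro span_sum span_scale span_base)
    then have "w \<noteq> 0"
      using v by (auto simp: w_def)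
    have wq: "q w b = 0" if "b \<in> B" for b
    proof -
      have "(\<Sum>c\<in>B. q v c * q c b) = (\<Sum>c\<in>B. if c = b then q v c else 0)"
        using that B(1) by (intro sum.cong) (auto simp: ON_def)
      then show ?thesis
        using that fin by (simp add: w_def bil q_sum)
    qed
    define z where "z = (1 / sqrt (q w w)) *\<^sub>R w"
    have z: "q z z = 1" "\<And>b. b \<in> B \<Longrightarrow> q z b = 0" "\<And>b. b \<in> B \<Longrightarrow> q b z = 0"
      using pos[OF \<open>w \<noteq> 0\<close>] wq sym by (simp_all add: z_def bil)
    then have "z \<notin> B" by fastforce
    with z B(1) have "ON (insert z B)"
      by (auto simp: ON_def)
    with B(2) \<open>z \<notin> B\<close> fin show False
      by fastforce
  qed
  then obtain e where e: "bij_betw e (UNIV :: 'n set) B"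
    using fin finite_same_card_bij by (metis finite_class.finite_UNIV)
  define P :: "real ^ 'n ^ 'n" where "P = (\<chi> i j. e j $ i)"
  have P_axis: "P *v axis j 1 = e j" for j
    by (simp add: P_def matrix_vector_mult_basis column_def vec_eq_iff)
  have "(transpose P ** A ** P) $ i $ j = q (e i) (e j)" for i j
  proof -
    have "(transpose P ** A ** P) $ i $ j = axis i 1 \<bullet> ((transpose P ** A ** P) *v axis j 1)"
      by (simp only: matrix_vector_mult_basis inner_axis' column_def) simp
    also have "\<dots> = axis i 1 \<bullet> (transpose P *v (A *v (P *v axis j 1)))"
      by (simp only: matrix_vector_mul_assoc matrix_mul_assoc)
    also have "\<dots> = (P *v axis i 1) \<bullet> (A *v (P *v axis j 1))"
      by (metis dot_lmul_matrix transpose_matrix_vector transpose_transpose)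
    finally show ?thesis by (simp only: q_def P_axis)
  qed
  moreover have "q (e i) (e j) = of_bool (i = j)" for i j
    using B(1) e by (auto simp: ON_def bij_betw_def inj_on_def)
  ultimately have "transpose P ** A ** P = mat 1"
    by (simp add: vec_eq_iff mat_def)
  then show ?thesis ..
qed

section \<open>The Gaussian law and the mixture\<close>

lemma matrix_inv_eqI:
  fixes A B :: "'a::field ^ 'n ^ 'n"
  assumes "A ** B = mat 1"
  shows "matrix_inv A = B"
proof -
  have BA: "B ** A = mat 1"
    using assms matrix_left_right_inverse by blast
  \<comment> \<open>\<open>matrix_inv\<close> is a Hilbert choice: \<open>B\<close> witnesses that a
    two-sided inverse exists, and uniqueness of inverses then identifies the two.\<close>
  have "A ** matrix_inv A = mat 1 \<and> matrix_inv A ** A = mat 1"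
    unfolding matrix_inv_def by (rule someI[of _ B]) (simp add: assms BA)
  then show ?thesis
    by (metis BA matrix_mul_assoc matrix_mul_lid matrix_mul_rid)
qed

lemma scaleR_matrix_mult:
  fixes A B :: "real ^ 'n ^ 'n"
  shows "(c *\<^sub>R A) ** (d *\<^sub>R B) = (c * d) *\<^sub>R (A ** B)"
  by (simp add: vec_eq_iff matrix_matrix_mult_def sum_distrib_left mult_ac)

lemma det_scaleR:
  fixes A :: "real ^ 'n ^ 'n"
  shows "det (c *\<^sub>R A) = c ^ CARD('n) * det A"
proof -
  have "c *\<^sub>R A = mat c ** A"
    by (simp add: vec_eq_iff matrix_matrix_mult_def mat_def if_distrib[of "\<lambda>x. x * y" for y] cong: if_cong)
  then show ?thesis
    by (metis det_matrix_scaleR det_mul matrix_scaleR)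
qed

text \<open>The quadratic form vanishes on the kernel, so the kernel is trivial and the square
  matrix is invertible.\<close>

lemma pos_def_mult_inv:
  assumes "pos_def A"
  shows "A ** matrix_inv A = mat 1" "matrix_inv A ** A = mat 1"
proof -
  have "x = 0" if "A *v x = 0" for x
    using assms that by (metis inner_zero_right less_irrefl pos_def_def)
  then obtain B where "B ** A = mat 1"
    using matrix_left_invertible_ker by blast
  then have "A ** B = mat 1" "B ** A = mat 1"
    using matrix_left_right_inverse by blast+
  then show "A ** matrix_inv A = mat 1" "matrix_inv A ** A = mat 1"
    by (simp_all add: matrix_inv_eqI)
qed

text \<open>With \<open>x = matrix_inv A *v v\<close>, the form of the inverse at \<open>v\<close>
  is the form of \<open>A\<close> at \<open>x\<close>.\<close>

lemma pos_def_matrix_inv: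
  assumes A: "pos_def A"
  shows "pos_def (matrix_inv A)"
proof -
  have inv_r: "A *v (matrix_inv A *v x) = x" for x
    by (simp only: matrix_vector_mul_assoc pos_def_mult_inv[OF A] matrix_vector_mul_lid)
  have "A ** transpose (matrix_inv A) = transpose (matrix_inv A ** A)"
    using A by (simp add: matrix_transpose_mul pos_def_def)
  then have "transpose (matrix_inv A) = matrix_inv A"
    using matrix_inv_eqI pos_def_mult_inv[OF A] by (metis transpose_mat)
  moreover have "0 < v \<bullet> (matrix_inv A *v v)" if "v \<noteq> 0" for v
    using A that inv_r by (metis inner_commute matrix_vector_mult_0_right pos_def_def)
  ultimately show ?thesis
    by (simp add: pos_def_def)
qed

lemma pos_def_scaleR:
  assumes "pos_def A" "0 < c"
  shows "pos_def (c *\<^sub>R A)"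
  using assms by (auto simp: pos_def_def transpose_def vec_eq_iff scaleR_matrix_vector_assoc[symmetric])

lemma matrix_inv_scaleR:
  fixes A :: "real ^ 'n ^ 'n"
  assumes "pos_def A" "c \<noteq> 0"
  shows "matrix_inv (c *\<^sub>R A) = (1 / c) *\<^sub>R matrix_inv A"
  using assms by (intro matrix_inv_eqI) (simp add: scaleR_matrix_mult pos_def_mult_inv)

text \<open>The form attains a positive minimum on the compact unit sphere, and homogeneity extends
  the bound to all vectors. Applied to the inverse covariance, \<open>l\<close> sets the rate of the
  Gaussian tail.\<close>

lemma pos_def_lower_bound:
  fixes A :: "real ^ 'n ^ 'n"
  assumes "pos_def A"
  obtains l where "0 < l" "\<And>v. l * (norm v)\<^sup>2 \<le> v \<bullet> (A *v v)"
proof -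
  have ne: "sphere (0 :: real ^ 'n) 1 \<noteq> {}"
    using vector_choose_size[of 1] by (metis dist_0_norm mem_sphere empty_iff zero_le_one)
  have "continuous_on (sphere 0 1) (\<lambda>v. v \<bullet> (A *v v))"
    by (intro continuous_intros linear_continuous_on_compose[of _ id] matrix_vector_mul_linear
        linear_continuous_on) simp_all
  then obtain u where u: "u \<in> sphere 0 1" "\<And>v. v \<in> sphere 0 1 \<Longrightarrow> u \<bullet> (A *v u) \<le> v \<bullet> (A *v v)"
    using continuous_attains_inf[OF compact_sphere ne] by blast
  show ?thesis
  proof
    show "0 < u \<bullet> (A *v u)"
    proof -
      have "u \<noteq> 0" using u(1) by auto
      then show ?thesis using assms by (simp add: pos_def_def)
    qed
    fix v :: "real ^ 'n"
    show "u \<bullet> (A *v u) * (norm v)\<^sup>2 \<le> v \<bullet> (A *v v)"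
    proof (cases "v = 0")
      case False
      define w where "w = (1 / norm v) *\<^sub>R v"
      have "v \<bullet> (A *v v) = (norm v)\<^sup>2 * (w \<bullet> (A *v w))"
        using False by (simp add: w_def matrix_vector_mult_scaleR power2_eq_square)
      moreover have "u \<bullet> (A *v u) \<le> w \<bullet> (A *v w)"
        using False by (intro u(2)) (simp add: w_def)
      ultimately show ?thesis
        by (simp add: mult.commute[of _ "(norm v)\<^sup>2"] mult_left_mono)
    qed simp
  qed
qed

text \<open>Taking determinants in the congruence gives \<open>(det P)\<^sup>2 = det A\<close>. So
  the Jacobian of \<open>P\<close> matches the normalising factor of the Gaussian density.\<close>

lemma det_sqrt_pos_def:
  assumes "transpose P ** matrix_inv A ** P = mat 1" and A: "pos_def A"
  shows "\<bar>det P\<bar> = sqrt (det A)" "0 < det A"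
proof -
  have "det (matrix_inv A) * det A = 1"
    using pos_def_mult_inv(2)[OF A] by (metis det_I det_mul)
  moreover have "(det P)\<^sup>2 * det (matrix_inv A) = 1"
    using arg_cong[OF assms(1), of det] by (simp add: det_mul power2_eq_square mult_ac)
  ultimately have eq: "(det P)\<^sup>2 = det A" and "det P \<noteq> 0"
    by (metis mult.assoc mult_1 mult_1_right, auto)
  show "\<bar>det P\<bar> = sqrt (det A)"
    by (simp flip: eq)
  show "0 < det A"
    using \<open>det P \<noteq> 0\<close> by (simp flip: eq)
qed

section \<open>The Gaussian measure: total mass, tails and hyperplanes\<close>

lemma borel_measurable_matrix_vector_mult[measurable (raw)]:
  fixes f :: "'a \<Rightarrow> real ^ 'n" and A :: "real ^ 'n ^ 'm"
  assumes "f \<in> borel_measurable M"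
  shows "(\<lambda>x. A *v f x) \<in> borel_measurable M"
  using measurable_compose[OF assms borel_measurable_continuous_onI[OF linear_continuous_on]]
    matrix_vector_mul_bounded_linear[of A] by blast

lemma sets_mv_normal[simp, measurable_cong]: "sets (mv_normal m A) = sets borel"
  by (simp add: mv_normal_def)

text \<open>The substitution \<open>x = m + P *v u\<close> turns the quadratic form into
  \<open>u \<bullet> u\<close>, and its Jacobian cancels \<open>sqrt (det A)\<close>; the standard
  Gaussian integral is left.\<close>

lemma prob_space_mv_normal:
  fixes A :: "real ^ 'n ^ 'n"
  assumes A: "pos_def A"
  shows "prob_space (mv_normal m A)"
proof
  obtain P :: "real ^ 'n ^ 'n" where P: "transpose P ** matrix_inv A ** P = mat 1"
    using pos_def_congruent_identity[OF pos_def_matrix_inv[OF A]] by blast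
  note det = det_sqrt_pos_def[OF P A]
  have inv: "invertible P"
    using det by (auto simp: invertible_det_nz)
  define f where "f x = ennreal (exp (- ((x - m) \<bullet> (matrix_inv A *v (x - m))) / 2)
      / sqrt ((2 * pi) ^ CARD('n) * det A))" for x
  have [measurable]: "f \<in> borel_measurable borel"
    unfolding f_def by measurable
  have q: "(P *v u) \<bullet> (matrix_inv A *v (P *v u)) = u \<bullet> u" for u
  proof -
    have "(P *v u) \<bullet> (matrix_inv A *v (P *v u)) = u \<bullet> (transpose P *v (matrix_inv A *v (P *v u)))"
      by (metis dot_lmul_matrix transpose_matrix_vector transpose_transpose)
    also have "\<dots> = u \<bullet> ((transpose P ** matrix_inv A ** P) *v u)"
      by (simp only: matrix_vector_mul_assoc matrix_mul_assoc)
    finally show ?thesis by (simp add: P)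
  qed
  have "emeasure (mv_normal m A) (space (mv_normal m A)) = (\<integral>\<^sup>+x. f x \<partial>lborel)"
    by (simp add: mv_normal_def f_def emeasure_density)
  also have "\<dots> = (\<integral>\<^sup>+x. f (m + x) \<partial>lborel)"
    by (subst lborel_distr_plus[of m, symmetric]) (simp add: nn_integral_distr)
  also have "\<dots> = (\<integral>\<^sup>+u. ennreal \<bar>det P\<bar> * f (m + P *v u) \<partial>lborel)"
    by (subst lborel_linear_cart[OF inv]) (simp add: nn_integral_density nn_integral_distr)
  also have "\<dots> = (\<integral>\<^sup>+u. ennreal (exp (- (u \<bullet> u) / 2) / sqrt ((2 * pi) ^ CARD('n)))
      \<partial>(lborel :: (real ^ 'n) measure))"
    using det by (intro nn_integral_cong) (simp add: f_def q real_sqrt_mult flip: ennreal_mult')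
  also have "\<dots> = 1"
    by (rule nn_integral_std_gaussian_cart)
  finally show "emeasure (mv_normal m A) (space (mv_normal m A)) = 1" .
qed

text \<open>On the tail, the density at inverse temperature \<open>\<kappa>\<close> is at most the claimed constant times
  the density at \<open>\<kappa> / 2\<close>.\<close>
lemma emeasure_mv_normal_tail:
  fixes S :: "real ^ 'n ^ 'n"
  assumes S: "pos_def S" and l: "0 < l" "\<And>v. l * (norm v)\<^sup>2 \<le> v \<bullet> (matrix_inv S *v v)"
    and k: "0 < k" and e: "0 < e"
  shows "emeasure (mv_normal m ((1 / k) *\<^sub>R S)) {x. e < norm (x - m)}
    \<le> ennreal (sqrt (2 ^ CARD('n)) * exp (- (k * l * e\<^sup>2 / 4)))"
proof -
  define q where "q x = (x - m) \<bullet> (matrix_inv S *v (x - m))" for x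
  define D where "D = (2 * pi) ^ CARD('n) * det ((1 / k) *\<^sub>R S)"
  define C where "C = sqrt (2 ^ CARD('n)) * exp (- (k * l * e\<^sup>2 / 4))"
  define f where "f x = ennreal (exp (- (k * q x) / 2) / sqrt D)" for x
  \<comment> \<open>The density at \<open>k / 2\<close>: doubling the covariance multiplies its
    determinant by \<open>2 ^ CARD('n)\<close>.\<close>
  define g where "g x = ennreal (exp (- (k / 2 * q x) / 2) / sqrt (2 ^ CARD('n) * D))" for x
  have meas[measurable]: "q \<in> borel_measurable borel" "f \<in> borel_measurable borel"
    "g \<in> borel_measurable borel"
    unfolding f_def g_def q_def by measurable
  have f: "mv_normal m ((1 / k) *\<^sub>R S) = density lborel f"
    using k unfolding mv_normal_def f_def[abs_def] q_def D_def
    by (simp add: matrix_inv_scaleR[OF S] scaleR_matrix_vector_assoc[symmetric])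
  have g: "mv_normal m ((2 / k) *\<^sub>R S) = density lborel g"
    using k unfolding mv_normal_def g_def[abs_def] q_def D_def
    by (simp add: matrix_inv_scaleR[OF S] det_scaleR scaleR_matrix_vector_assoc[symmetric]
        power_divide mult_ac)
  have D: "0 < D"
  proof -
    have pd: "pos_def ((1 / k) *\<^sub>R S)"
      using S k by (simp add: pos_def_scaleR)
    then obtain P :: "real ^ 'n ^ 'n" where "transpose P ** matrix_inv ((1 / k) *\<^sub>R S) ** P = mat 1"
      using pos_def_congruent_identity[OF pos_def_matrix_inv] by blast
    then show ?thesis
      using det_sqrt_pos_def(2)[OF _ pd] by (simp add: D_def)
  qed
  have le: "f x \<le> ennreal C * g x" if "e < norm (x - m)" for x
  proof -
    have "e\<^sup>2 \<le> (norm (x - m))\<^sup>2"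
      using that e by (intro power_mono) auto
    then have "l * e\<^sup>2 \<le> q x"
      using l(2)[of "x - m"] l(1) unfolding q_def by (meson mult_left_mono less_imp_le order_trans)
    then have "k * l * e\<^sup>2 \<le> k * q x"
      using k by (simp add: mult.assoc)
    \<comment> \<open>The exponent is halved: one half is bounded by its value on the tail, the
      other is kept as the exponent of \<open>g\<close>.\<close>
    then have "exp (- (k * q x) / 2) \<le> exp (- (k * l * e\<^sup>2 / 4)) * exp (- (k / 2 * q x) / 2)"
      by (simp flip: exp_add)
    then have "exp (- (k * q x) / 2) / sqrt D
        \<le> exp (- (k * l * e\<^sup>2 / 4)) * exp (- (k / 2 * q x) / 2) / sqrt D"
      using D by (intro divide_right_mono) auto
    also have "\<dots> = C * (exp (- (k / 2 * q x) / 2) / sqrt (2 ^ CARD('n) * D))"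
      using D by (simp add: C_def real_sqrt_mult)
    finally show ?thesis
      by (simp add: f_def g_def C_def ennreal_leI flip: ennreal_mult')
  qed
  have "emeasure (mv_normal m ((1 / k) *\<^sub>R S)) {x. e < norm (x - m)}
      = (\<integral>\<^sup>+x. f x * indicator {x. e < norm (x - m)} x \<partial>lborel)"
    unfolding f by (subst emeasure_density) auto
  also have "\<dots> \<le> (\<integral>\<^sup>+x. ennreal C * g x \<partial>lborel)"
    using le by (intro nn_integral_mono) (auto simp: indicator_def)
  also have "\<dots> = ennreal C * emeasure (mv_normal m ((2 / k) *\<^sub>R S)) UNIV"
    unfolding g by (simp add: emeasure_density nn_integral_cmult)
  also have "emeasure (mv_normal m ((2 / k) *\<^sub>R S)) UNIV = 1"
    using prob_space.emeasure_space_1[OF prob_space_mv_normal[OF pos_def_scaleR[OF S]]] k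
    by (simp add: mv_normal_def)
  finally show ?thesis
    by (simp add: C_def)
qed

text \<open>Hyperplanes are Lebesgue null, and the law is given by a density.\<close>

lemma emeasure_mv_normal_hyperplane:
  fixes a :: "real ^ 'n"
  assumes "a \<noteq> 0"
  shows "emeasure (mv_normal m A) {x. a \<bullet> x = c} = 0"
proof -
  have "{x. a \<bullet> x = c} \<in> null_sets lebesgue"
    using assms by (simp add: negligible_hyperplane flip: negligible_iff_null_sets)
  moreover have "{x. a \<bullet> x = c} \<in> sets lborel"
    by simp
  ultimately have "AE x in lborel. x \<notin> {x. a \<bullet> x = c}"
    by (intro AE_not_in) (simp add: null_sets_completion_iff)
  moreover have "(\<lambda>x. ennreal (exp (- ((x - m) \<bullet> (matrix_inv A *v (x - m))) / 2)
      / sqrt ((2 * pi) ^ CARD('n) * det A))) \<in> borel_measurable lborel"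
    by measurable
  ultimately have "AE x in mv_normal m A. x \<notin> {x. a \<bullet> x = c}"
    unfolding mv_normal_def by (subst AE_density) auto
  then show ?thesis
    by (subst (asm) AE_iff_measurable[OF _ refl]) (auto simp: mv_normal_def)
qed

section \<open>The label mixture and its signed points\<close>

abbreviation data_space :: "((real ^ 'd) \<times> nat) measure" where
  "data_space \<equiv> borel \<Otimes>\<^sub>M count_space UNIV"

text \<open>Absorbing the label into the point makes every margin constraint a half-space condition
  on \<open>w\<close>.\<close>

definition signed_point :: "(real ^ 'd) \<times> nat \<Rightarrow> real ^ 'd" where
  "signed_point p = (2 * real (snd p) - 1) *\<^sub>R fst p"

lemma signed_margin_eq: "signed_margin w p = w \<bullet> signed_point p"
  by (simp add: signed_margin_def signed_point_def)

lemma borel_measurable_signed_point[measurable]: "signed_point \<in> borel_measurable data_space"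
  unfolding signed_point_def by measurable

lemma sets_signed_point:
  assumes "X \<in> sets borel"
  shows "{p. signed_point p \<in> X} \<in> sets data_space"
  using measurable_sets[OF borel_measurable_signed_point assms]
  by (simp add: vimage_def space_pair_measure)

context
  fixes \<mu> :: "real ^ 'd" and A :: "real ^ 'd ^ 'd" and k :: real
  assumes A: "pos_def A" and k: "0 < k"
begin

text \<open>The label space is discrete, so measurability of the kernel only asks that each
  conditional law be a subprobability on the data space. The rules for \<open>bind\<close> require
  both facts.\<close>

lemma mixture_kernel:
  "(\<lambda>y. distr (mv_normal (if y = 1 then \<mu> else - \<mu>) ((1 / k) *\<^sub>R A)) data_space (\<lambda>x. (x, y)))
    \<in> measurable (measure_pmf (pmf_of_set {0, 1 :: nat})) (subprob_algebra data_space)"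
  and mixture_kernel_prob: "prob_space (distr (mv_normal (if y = (1::nat) then \<mu> else - \<mu>)
    ((1 / k) *\<^sub>R A)) data_space (\<lambda>x. (x, y)))"
proof -
  show prob: "prob_space (distr (mv_normal (if y = (1::nat) then \<mu> else - \<mu>)
    ((1 / k) *\<^sub>R A)) data_space (\<lambda>x. (x, y)))" for y
    using A k by (intro prob_space.prob_space_distr prob_space_mv_normal pos_def_scaleR) auto
  then show "(\<lambda>y. distr (mv_normal (if y = 1 then \<mu> else - \<mu>) ((1 / k) *\<^sub>R A)) data_space (\<lambda>x. (x, y)))
    \<in> measurable (measure_pmf (pmf_of_set {0, 1 :: nat})) (subprob_algebra data_space)"
    by (auto simp: space_subprob_algebra prob_space_imp_subprob_space)
qed

lemma sets_mixture: "sets (mixture \<mu> A k) = sets data_space"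
  unfolding mixture_def by (rule sets_bind_measurable[OF mixture_kernel]) simp

lemma prob_space_mixture: "prob_space (mixture \<mu> A k)"
  unfolding mixture_def
  by (intro prob_space.prob_space_bind[OF _ _ mixture_kernel] measure_pmf.prob_space_axioms
      AE_I2 mixture_kernel_prob)

text \<open>Both conditional laws of the signed point are the Gaussian centred at \<open>\<mu>\<close>; the reflection in the
  second hypothesis avoids computing an image measure.\<close>
lemma emeasure_mixture_le:
  assumes X[measurable]: "X \<in> sets borel"
    and "emeasure (mv_normal \<mu> ((1 / k) *\<^sub>R A)) X \<le> b"
    and "emeasure (mv_normal (- \<mu>) ((1 / k) *\<^sub>R A)) (uminus -` X) \<le> b"
  shows "emeasure (mixture \<mu> A k) {p. signed_point p \<in> X} \<le> b"
proof -
  let ?K = "\<lambda>y. distr (mv_normal (if y = 1 then \<mu> else - \<mu>) ((1 / k) *\<^sub>R A)) data_space (\<lambda>x. (x, y))"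
  note [measurable] = sets_signed_point[OF X]
  have "emeasure (?K y) {p. signed_point p \<in> X} \<le> b" if "y \<in> {0, 1 :: nat}" for y
  proof -
    have "emeasure (?K y) {p. signed_point p \<in> X}
        = emeasure (mv_normal (if y = 1 then \<mu> else - \<mu>) ((1 / k) *\<^sub>R A)) {x. signed_point (x, y) \<in> X}"
      by (subst emeasure_distr) (auto simp: mv_normal_def vimage_def)
    then show ?thesis
      using that assms(2,3) by (auto simp: signed_point_def vimage_def)
  qed
  then have "AE y in measure_pmf (pmf_of_set {0, 1}). emeasure (?K y) {p. signed_point p \<in> X} \<le> b"
    by (simp add: AE_measure_pmf_iff)
  then have "(\<integral>\<^sup>+y. emeasure (?K y) {p. signed_point p \<in> X} \<partial>measure_pmf (pmf_of_set {0, 1}))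
      \<le> (\<integral>\<^sup>+y. b \<partial>measure_pmf (pmf_of_set {0, 1 :: nat}))"
    by (rule nn_integral_mono_AE)
  then show ?thesis
    unfolding mixture_def by (subst emeasure_bind[OF _ mixture_kernel]) simp_all
qed

lemma emeasure_mixture_tail:
  assumes "0 < l" "\<And>v. l * (norm v)\<^sup>2 \<le> v \<bullet> (matrix_inv A *v v)" "0 < e"
  shows "emeasure (mixture \<mu> A k) {p. e < norm (signed_point p - \<mu>)}
    \<le> ennreal (sqrt (2 ^ CARD('d)) * exp (- (k * l * e\<^sup>2 / 4)))"
proof -
  have "uminus -` {x. e < norm (x - \<mu>)} = {x. e < norm (x - - \<mu>)}"
    by (auto simp: norm_minus_commute[of "- x" \<mu> for x] add.commute)
  moreover have "{x. e < norm (x - \<mu>)} \<in> sets borel"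
    by measurable
  ultimately show ?thesis
    using emeasure_mixture_le[of "{x. e < norm (x - \<mu>)}"] emeasure_mv_normal_tail[OF A assms(1,2) k assms(3), of \<mu>]
      emeasure_mv_normal_tail[OF A assms(1,2) k assms(3), of "- \<mu>"]
    by simp
qed

text \<open>The source of general position: a normal orthogonal to \<mu> shows that no signed point
  is parallel to \<mu>, and the normal \<mu> shows that the values \<open>\<mu> \<bullet> z\<close>
  have no atoms.\<close>

lemma AE_mixture_hyperplane:
  assumes "a \<noteq> 0"
  shows "AE p in mixture \<mu> A k. a \<bullet> signed_point p \<noteq> c"
proof -
  have "uminus -` {x. a \<bullet> x = c} = {x. a \<bullet> x = - c}"
    by auto
  then have "emeasure (mixture \<mu> A k) {p. signed_point p \<in> {x. a \<bullet> x = c}} \<le> 0"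
    by (intro emeasure_mixture_le) (simp_all add: emeasure_mv_normal_hyperplane[OF assms])
  moreover have "{p. signed_point p \<in> {x. a \<bullet> x = c}} \<in> sets (mixture \<mu> A k)"
    unfolding sets_mixture by (rule sets_signed_point) simp
  ultimately show ?thesis
    using AE_not_in[of "{p. signed_point p \<in> {x. a \<bullet> x = c}}"] by (simp add: null_sets_def)
qed

end

section \<open>Geometry of the maximum-margin vector\<close>

text \<open>An intersection of closed half-spaces, so that \<open>max_margin\<close> can be studied
  as the projection of the origin onto a closed convex set.\<close>

definition feasible :: "nat \<Rightarrow> (nat \<Rightarrow> (real ^ 'd) \<times> nat) \<Rightarrow> (real ^ 'd) set" where
  "feasible n S = {w. \<forall>i\<in>{1..n}. 1 \<le> w \<bullet> signed_point (S i)}"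

lemma convex_feasible: "convex (feasible n S)"
proof -
  have "feasible n S = (\<Inter>i\<in>{1..n}. {w. signed_point (S i) \<bullet> w \<ge> 1})"
    by (auto simp: feasible_def inner_commute)
  then show ?thesis
    by (simp add: convex_INT convex_halfspace_ge)
qed

lemma closed_feasible: "closed (feasible n S)"
proof -
  have "feasible n S = (\<Inter>i\<in>{1..n}. {w. signed_point (S i) \<bullet> w \<ge> 1})"
    by (auto simp: feasible_def inner_commute)
  then show ?thesis
    by (simp add: closed_INT closed_halfspace_ge)
qed

lemma linearly_separable_iff:
  "linearly_separable n S \<longleftrightarrow> (\<exists>w. \<forall>i\<in>{1..n}. 0 < w \<bullet> signed_point (S i))"
  by (simp add: linearly_separable_def signed_margin_eq)

text \<open>Dividing a separating vector by its least margin makes it feasible; without samples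
  there is no constraint.\<close>

lemma feasible_nonempty:
  assumes "linearly_separable n S"
  shows "feasible n S \<noteq> {}"
proof (cases "n = 0")
  case False
  obtain w where w: "\<And>i. i \<in> {1..n} \<Longrightarrow> 0 < w \<bullet> signed_point (S i)"
    using assms unfolding linearly_separable_iff by blast
  define c where "c = Min ((\<lambda>i. w \<bullet> signed_point (S i)) ` {1..n})"
  have c: "0 < c" "\<And>i. i \<in> {1..n} \<Longrightarrow> c \<le> w \<bullet> signed_point (S i)"
    using False w by (auto simp: c_def)
  then have "(1 / c) *\<^sub>R w \<in> feasible n S"
    by (auto simp: feasible_def)
  then show ?thesis by blast
qed (simp add: feasible_def)

text \<open>\<open>arg_min\<close> is a choice and says something only once a minimiser is known.
  The closest point supplies one, and projections onto closed convex sets are unique.\<close>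

lemma max_margin_eq_closest_point:
  assumes "linearly_separable n S"
  shows "max_margin n S = closest_point (feasible n S) 0"
proof (rule closest_point_unique[OF convex_feasible closed_feasible])
  let ?c = "closest_point (feasible n S) 0"
  have c: "?c \<in> feasible n S" "\<And>w. w \<in> feasible n S \<Longrightarrow> norm ?c \<le> norm w"
    using closest_point_exists[OF closed_feasible feasible_nonempty[OF assms], of 0] by auto
  have "max_margin n S \<in> feasible n S \<and> (\<forall>w. w \<in> feasible n S \<longrightarrow> \<not> (norm w)\<^sup>2 < (norm (max_margin n S))\<^sup>2)"
    unfolding max_margin_def
  proof (rule arg_minI)
    show "\<forall>i\<in>{1..n}. 1 \<le> signed_margin ?c (S i)"
      using c(1) by (simp add: feasible_def signed_margin_eq)
    show "\<not> (norm w)\<^sup>2 < (norm ?c)\<^sup>2" if "\<forall>i\<in>{1..n}. 1 \<le> signed_margin w (S i)" for w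
      using c(2)[of w] that by (simp add: feasible_def signed_margin_eq not_less power_mono)
  qed (simp add: feasible_def signed_margin_eq)
  then show "max_margin n S \<in> feasible n S" "\<forall>w\<in>feasible n S. dist 0 (max_margin n S) \<le> dist 0 w"
    by (auto simp: not_less)
qed

lemma max_margin_feasible:
  assumes "linearly_separable n S"
  shows "max_margin n S \<in> feasible n S"
  using closest_point_in_set[OF closed_feasible feasible_nonempty[OF assms]]
  by (simp add: max_margin_eq_closest_point[OF assms])

text \<open>The variational inequality that characterises the projection of the origin.\<close>

lemma max_margin_dot:
  assumes "linearly_separable n S" "w \<in> feasible n S"
  shows "(norm (max_margin n S))\<^sup>2 \<le> max_margin n S \<bullet> w"
  using closest_point_dot[OF convex_feasible closed_feasible assms(2), of 0]
  by (simp add: max_margin_eq_closest_point[OF assms(1)] inner_diff_right dot_square_norm)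

lemma norm_max_margin_le:
  assumes "linearly_separable n S" "w \<in> feasible n S"
  shows "norm (max_margin n S) \<le> norm w"
  using closest_point_le[OF closed_feasible assms(2), of 0]
  by (simp add: max_margin_eq_closest_point[OF assms(1)])

text \<open>A quantitative form of uniqueness: nearly optimal feasible vectors lie near the
  minimiser. It follows by expanding the square.\<close>

lemma norm_diff_max_margin_le:
  assumes "linearly_separable n S" "w \<in> feasible n S"
  shows "(norm (w - max_margin n S))\<^sup>2 \<le> (norm w)\<^sup>2 - (norm (max_margin n S))\<^sup>2"
  using max_margin_dot[OF assms]
  by (simp add: power2_norm_eq_inner inner_diff_left inner_diff_right inner_commute)

lemma max_margin_nonzero:
  assumes "linearly_separable n S" "1 \<le> n"
  shows "max_margin n S \<noteq> 0"
  using max_margin_feasible[OF assms(1)] assms(2) by (auto simp: feasible_def)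

section \<open>Cosine similarity and samples close to the mean\<close>

lemma sim_le_1: "sim u v \<le> 1"
  using norm_cauchy_schwarz[of u v] by (cases "u = 0 \<or> v = 0") (auto simp: sim_def divide_le_eq_1)

lemma sim_eq_1_iff:
  assumes "u \<noteq> 0" "v \<noteq> 0"
  shows "sim u v = 1 \<longleftrightarrow> norm u *\<^sub>R v = norm v *\<^sub>R u"
  unfolding norm_cauchy_schwarz_eq[symmetric] using assms by (auto simp: sim_def)

text \<open>The chordal distance of the normalised vectors bounds the difference of their similarities to
  any third vector.\<close>
lemma sim_le_sim_add:
  assumes "u \<noteq> 0" "v \<noteq> 0" "w \<noteq> 0"
  shows "sim w v \<le> sim u v + sqrt (2 - 2 * sim w u)"
proof -
  have sim_sgn: "sim x y = sgn x \<bullet> sgn y" for x y :: "real ^ 'n"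
    by (simp add: sim_def sgn_div_norm field_simps)
  have norm_sgn1: "norm (sgn u) = 1" "norm (sgn v) = 1" "norm (sgn w) = 1"
    using assms by (simp_all add: norm_sgn)
  have "sim w v - sim u v = (sgn w - sgn u) \<bullet> sgn v"
    by (simp add: sim_sgn inner_diff_left)
  also have "\<dots> \<le> norm (sgn w - sgn u)"
    using norm_cauchy_schwarz[of "sgn w - sgn u" "sgn v"] by (simp add: norm_sgn1)
  also have "\<dots> = sqrt (2 - 2 * sim w u)"
    using norm_sgn1
    by (simp add: norm_eq_sqrt_inner inner_diff_left inner_diff_right sim_sgn inner_commute)
  finally show ?thesis by simp
qed

text \<open>By Cauchy-Schwarz every margin of \<mu> is at least
  \<open>norm \<mu> * (norm \<mu> - e)\<close>, and dividing by this number gives a feasible vector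
  of norm \<open>1 / (norm \<mu> - e)\<close>.\<close>

lemma near_mean_feasible:
  assumes \<mu>: "\<mu> \<noteq> 0" and e: "e < norm \<mu>"
    and near: "\<And>i. i \<in> {1..n} \<Longrightarrow> norm (signed_point (S i) - \<mu>) \<le> e"
  shows "linearly_separable n S" and "(1 / (norm \<mu> * (norm \<mu> - e))) *\<^sub>R \<mu> \<in> feasible n S"
proof -
  have c: "0 < norm \<mu> * (norm \<mu> - e)"
    using \<mu> e by simp
  have mu: "norm \<mu> * (norm \<mu> - e) \<le> \<mu> \<bullet> signed_point (S i)" if "i \<in> {1..n}" for i
  proof -
    have "- (\<mu> \<bullet> (signed_point (S i) - \<mu>)) \<le> norm \<mu> * norm (signed_point (S i) - \<mu>)"
      using Cauchy_Schwarz_ineq2[of \<mu> "signed_point (S i) - \<mu>"] by linarith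
    also have "\<dots> \<le> norm \<mu> * e"
      using near[OF that] by (simp add: mult_left_mono)
    finally show ?thesis
      by (simp add: inner_diff_right dot_square_norm right_diff_distrib power2_eq_square)
  qed
  show "linearly_separable n S"
    using mu c unfolding linearly_separable_iff by (meson less_le_trans)
  show "(1 / (norm \<mu> * (norm \<mu> - e))) *\<^sub>R \<mu> \<in> feasible n S"
    using mu c by (simp add: feasible_def)
qed

text \<open>The feasible multiple of \<mu> bounds the norm of the minimiser \<open>w\<close> from
  above, so \<open>1 \<ge> (norm \<mu> - e) * norm w\<close>. A single constraint gives
  \<open>w \<bullet> \<mu> \<ge> 1 - e * norm w\<close>; the two combine to the bound.\<close>

lemma sim_max_margin_mean_ge:
  assumes n: "1 \<le> n" and \<mu>: "\<mu> \<noteq> 0" and e: "0 \<le> e" "e < norm \<mu>"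
    and near: "\<And>i. i \<in> {1..n} \<Longrightarrow> norm (signed_point (S i) - \<mu>) \<le> e"
  shows "1 - 2 * e / norm \<mu> \<le> sim (max_margin n S) \<mu>"
proof -
  define w where "w = max_margin n S"
  note nf = near_mean_feasible[where S = S and n = n, OF \<mu> e(2) near]
  have w0: "0 < norm w"
    using max_margin_nonzero[OF nf(1) n] by (simp add: w_def)
  have "norm w \<le> 1 / (norm \<mu> - e)"
    using norm_max_margin_le[OF nf] e \<mu> by (simp add: w_def)
  then have *: "(norm \<mu> - e) * norm w \<le> 1"
    using e by (simp add: field_simps)
  have "1 \<le> w \<bullet> signed_point (S 1)"
    using max_margin_feasible[OF nf(1)] n by (simp add: feasible_def w_def)
  moreover have "w \<bullet> (signed_point (S 1) - \<mu>) \<le> norm w * e"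
    using norm_cauchy_schwarz[of w "signed_point (S 1) - \<mu>"] near[of 1] n
    by (meson atLeastAtMost_iff mult_left_mono norm_ge_zero order_refl order_trans)
  ultimately have "(norm \<mu> - 2 * e) * norm w \<le> w \<bullet> \<mu>"
    using * by (simp add: inner_diff_right algebra_simps)
  then have "(norm \<mu> - 2 * e) * norm w / (norm w * norm \<mu>) \<le> sim w \<mu>"
    unfolding sim_def by (intro divide_right_mono) simp_all
  moreover have "(norm \<mu> - 2 * e) * norm w / (norm w * norm \<mu>) = 1 - 2 * e / norm \<mu>"
    using w0 \<mu> by (simp add: field_simps)
  ultimately show ?thesis by (simp add: w_def)
qed

text \<open>If the maximum-margin direction were \<open>\<mu>\<close>, some sample \<open>z\<close> would have the strictly smallest
  margin. Moving towards the projection onto the line of \<open>z\<close> keeps that margin and all the others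
  stay feasible for a short while, so minimality forces \<open>z\<close> to be parallel to \<open>\<mu>\<close>.\<close>
lemma max_margin_not_parallel:
  assumes sep: "linearly_separable n S" and n: "1 \<le> n" and a: "a \<bullet> \<mu> = 0"
    and a_z: "\<And>i. i \<in> {1..n} \<Longrightarrow> a \<bullet> signed_point (S i) \<noteq> 0"
    and distinct: "\<And>i j. i \<in> {1..n} \<Longrightarrow> j \<in> {1..n} \<Longrightarrow> i \<noteq> j \<Longrightarrow>
      \<mu> \<bullet> signed_point (S i) \<noteq> \<mu> \<bullet> signed_point (S j)"
  shows "max_margin n S \<noteq> t *\<^sub>R \<mu>"
proof
  define w where "w = max_margin n S"
  define z where "z i = signed_point (S i)" for i
  assume "max_margin n S = t *\<^sub>R \<mu>"
  then have w: "w = t *\<^sub>R \<mu>" by (simp add: w_def)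
  have w0: "w \<noteq> 0"
    using max_margin_nonzero[OF sep n] by (simp add: w_def)
  have feas: "1 \<le> w \<bullet> z i" if "i \<in> {1..n}" for i
    using max_margin_feasible[OF sep] that by (simp add: feasible_def w_def z_def)
  obtain i where i: "i \<in> {1..n}" "\<And>j. j \<in> {1..n} \<Longrightarrow> w \<bullet> z i \<le> w \<bullet> z j"
    using n finite_has_minimal[of "(\<lambda>j. w \<bullet> z j) ` {1..n}"]
    by (metis (no_types, lifting) arg_min_if_finite(1) arg_min_least atLeastAtMost_iff empty_iff
        finite_atLeastAtMost order_refl)
  have strict: "1 < w \<bullet> z j" if "j \<in> {1..n}" "j \<noteq> i" for j
  proof -
    have "w \<bullet> z i \<noteq> w \<bullet> z j"
      using distinct[of i j] i(1) that w0 by (simp add: w z_def)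
    then show ?thesis
      using i(2)[OF that(1)] feas[OF i(1)] by linarith
  qed
  define c where "c = w \<bullet> z i"
  have c: "1 \<le> c"
    using feas[OF i(1)] by (simp add: c_def)
  have z0: "z i \<noteq> 0"
    using a_z[OF i(1)] by (auto simp: z_def)
  \<comment> \<open>The point of the line through \<open>z i\<close> with the same margin
    \<open>c\<close>; it is the shortest vector having that margin.\<close>
  define p where "p = (c / (norm (z i))\<^sup>2) *\<^sub>R z i"
  have pz: "p \<bullet> z i = c"
    using z0 by (simp add: p_def dot_square_norm)
  have "\<forall>\<^sub>F s in at_right 0. \<forall>j\<in>{1..n}. 1 \<le> (w + s *\<^sub>R (p - w)) \<bullet> z j"
  proof (intro eventually_ball_finite ballI)
    fix j assume j: "j \<in> {1..n}"
    show "\<forall>\<^sub>F s in at_right 0. 1 \<le> (w + s *\<^sub>R (p - w)) \<bullet> z j"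
    proof (cases "j = i")
      case True
      then show ?thesis
        using c pz by (simp add: inner_add_left inner_diff_left c_def)
    next
      case False
      have "((\<lambda>s. (w + s *\<^sub>R (p - w)) \<bullet> z j) \<longlongrightarrow> (w + 0 *\<^sub>R (p - w)) \<bullet> z j) (at_right 0)"
        by (intro tendsto_intros)
      then have "\<forall>\<^sub>F s in at_right 0. 1 < (w + s *\<^sub>R (p - w)) \<bullet> z j"
        using strict[OF j False] by (intro order_tendstoD(1)) simp_all
      then show ?thesis
        by (rule eventually_mono) simp
    qed
  qed simp
  then have "\<forall>\<^sub>F s in at_right 0. 0 < s \<and> (\<forall>j\<in>{1..n}. 1 \<le> (w + s *\<^sub>R (p - w)) \<bullet> z j)"
    by (intro eventually_conj eventually_at_right_less)
  then have "\<exists>s. 0 < s \<and> (\<forall>j\<in>{1..n}. 1 \<le> (w + s *\<^sub>R (p - w)) \<bullet> z j)"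
    by (rule eventually_happens'[rotated]) simp
  then obtain s where s: "0 < s" "w + s *\<^sub>R (p - w) \<in> feasible n S"
    unfolding feasible_def z_def by blast
  \<comment> \<open>The variational inequality at the moved point gives
    \<open>(norm w)\<^sup>2 \<le> w \<bullet> p\<close>, which is Cauchy-Schwarz for
    \<open>w\<close> and \<open>z i\<close> reversed. The equality case then makes them
    parallel.\<close>
  have "(norm w)\<^sup>2 \<le> w \<bullet> (w + s *\<^sub>R (p - w))"
    using max_margin_dot[OF sep s(2)] by (simp add: w_def)
  then have "(norm w)\<^sup>2 \<le> w \<bullet> p"
    using s(1) by (simp add: inner_add_right inner_diff_right dot_square_norm zero_le_mult_iff)
  also have "\<dots> = c\<^sup>2 / (norm (z i))\<^sup>2"
    by (simp add: p_def c_def power2_eq_square)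
  finally have "(norm w * norm (z i))\<^sup>2 \<le> c\<^sup>2"
    using z0 by (simp add: field_simps power_mult_distrib)
  then have "norm w * norm (z i) \<le> c"
    by (rule power2_le_imp_le) (use c in simp)
  then have "w \<bullet> z i = norm w * norm (z i)"
    using norm_cauchy_schwarz[of w "z i"] by (simp add: c_def)
  then have "norm w *\<^sub>R z i = norm (z i) *\<^sub>R w"
    by (simp add: norm_cauchy_schwarz_eq)
  then have "norm w * (a \<bullet> z i) = norm (z i) * (a \<bullet> w)"
    by (metis inner_scaleR_right)
  then show False
    using a_z[OF i(1)] w0 by (simp add: w a z_def)
qed

text \<open>Scaling the minimiser by a factor slightly above one makes all constraints strict at
  little cost in norm. The vectors meeting both conditions thus form a nonempty open set, which the
  sequence \<open>d\<close> meets.\<close>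

lemma dense_strictly_feasible:
  assumes sep: "linearly_separable n S" and n: "1 \<le> n"
    and d: "\<And>X. open X \<Longrightarrow> X \<noteq> {} \<Longrightarrow> \<exists>k. d k \<in> X" and e: "0 < e"
  shows "\<exists>k::nat. (\<forall>i\<in>{1..n}. 1 < d k \<bullet> signed_point (S i)) \<and>
    (norm (d k))\<^sup>2 < (norm (max_margin n S))\<^sup>2 + e"
proof -
  define w where "w = max_margin n S"
  define U where "U = (\<Inter>i\<in>{1..n}. {v. 1 < v \<bullet> signed_point (S i)}) \<inter> {v. (norm v)\<^sup>2 < (norm w)\<^sup>2 + e}"
  have "open U"
    unfolding U_def
    by (intro open_Int open_INT ballI open_Collect_less continuous_intros) simp
  moreover have "U \<noteq> {}"
  proof -
    have "((\<lambda>s. (norm (s *\<^sub>R w))\<^sup>2) \<longlongrightarrow> (norm (1 *\<^sub>R w))\<^sup>2) (at_right 1)"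
      by (intro tendsto_intros)
    from order_tendstoD(2)[OF this, of "(norm w)\<^sup>2 + e"]
    have "\<forall>\<^sub>F s in at_right 1. (norm (s *\<^sub>R w))\<^sup>2 < (norm w)\<^sup>2 + e"
      using e by (simp only: scaleR_one less_add_same_cancel1)
    then have "\<forall>\<^sub>F s in at_right 1. 1 < s \<and> (norm (s *\<^sub>R w))\<^sup>2 < (norm w)\<^sup>2 + e"
      by (intro eventually_conj eventually_at_right_less)
    then have "\<exists>s. 1 < s \<and> (norm (s *\<^sub>R w))\<^sup>2 < (norm w)\<^sup>2 + e"
      by (rule eventually_happens'[rotated]) simp
    then obtain s where s: "1 < s" "(norm (s *\<^sub>R w))\<^sup>2 < (norm w)\<^sup>2 + e"
      by blast
    have "1 < s *\<^sub>R w \<bullet> signed_point (S i)" if "i \<in> {1..n}" for i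
    proof -
      have "1 \<le> w \<bullet> signed_point (S i)"
        using max_margin_feasible[OF sep] that by (simp add: feasible_def w_def)
      then have "s * 1 \<le> s * (w \<bullet> signed_point (S i))"
        using s(1) by (intro mult_left_mono) simp_all
      then show ?thesis
        using s(1) unfolding inner_scaleR_left by linarith
    qed
    then have "s *\<^sub>R w \<in> U"
      using s(2) by (simp add: U_def)
    then show ?thesis by blast
  qed
  ultimately show ?thesis
    using d[of U] unfolding U_def w_def by blast
qed

section \<open>Measurability and null events\<close>

text \<open>The minimiser is a limit of nearly optimal strictly feasible vectors from any countable dense
  set, which expresses the event through countably many conditions on the sample.\<close>
lemma sim_max_margin_less_iff:
  assumes sep: "linearly_separable n S" and n: "1 \<le> n"
    and d: "\<And>X. open X \<Longrightarrow> X \<noteq> {} \<Longrightarrow> \<exists>k::nat. d k \<in> X" and v: "v \<noteq> 0"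
  shows "sim (max_margin n S) v < t \<longleftrightarrow> (\<exists>N::nat. \<forall>k. (\<forall>i\<in>{1..n}. 1 < d k \<bullet> signed_point (S i)) \<longrightarrow>
      sim (d k) v \<le> t - 1 / Suc N \<or>
      (\<exists>k'. (\<forall>i\<in>{1..n}. 1 < d k' \<bullet> signed_point (S i)) \<and> (norm (d k'))\<^sup>2 + 1 / Suc N < (norm (d k))\<^sup>2))"
    (is "_ \<longleftrightarrow> (\<exists>N. \<forall>k. ?F k \<longrightarrow> ?G N k)")
proof -
  define w where "w = max_margin n S"
  have w0: "w \<noteq> 0"
    using max_margin_nonzero[OF sep n] by (simp add: w_def)
  have cont: "isCont (\<lambda>x. sim x v) w"
    unfolding sim_def using w0 v by (intro continuous_intros) simp_all
  have feas: "d k \<in> feasible n S" if "?F k" for k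
    using that by (auto simp: feasible_def intro: less_imp_le)
  have dense: "\<exists>k. ?F k \<and> (norm (d k))\<^sup>2 < (norm w)\<^sup>2 + e" if "0 < e" for e
    using dense_strictly_feasible[OF sep n d that] unfolding w_def by blast
  have near: "norm (d k - w) < e" if "?F k" "(norm (d k))\<^sup>2 < (norm w)\<^sup>2 + e\<^sup>2" "0 < e" for k e
  proof -
    have "(norm (d k - w))\<^sup>2 < e\<^sup>2"
      using norm_diff_max_margin_le[OF sep feas[OF that(1)]] that(2) by (simp add: w_def)
    then show ?thesis
      using that(3) by (simp add: power2_less_imp_less)
  qed
  show ?thesis
  proof
    assume "sim (max_margin n S) v < t"
    then have lt: "sim w v < t" by (simp add: w_def)
    define r where "r = (t - sim w v) / 2"
    have r: "0 < r" using lt by (simp add: r_def)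
    obtain e where e: "0 < e" "\<And>x. norm (x - w) < e \<Longrightarrow> \<bar>sim x v - sim w v\<bar> < r"
      using cont r unfolding isCont_def LIM_eq
      by (metis abs_zero cancel_comm_monoid_add_class.diff_cancel real_norm_def)
    \<comment> \<open>The first bound leaves a gap of \<open>1 / Suc N\<close> below
      \<open>t\<close>; the second forces any \<open>d k\<close> that is not beaten by
      \<open>1 / Suc N\<close> to lie within \<open>e\<close> of \<open>w\<close>.\<close>
    obtain N where N: "1 / Suc N < r" "1 / Suc N < e\<^sup>2 / 2"
      using reals_Archimedean[of "min r (e\<^sup>2 / 2)"] r e(1) by (auto simp: inverse_eq_divide)
    have "?G N k" if k: "?F k" for k
    proof (rule disjCI)
      assume no: "\<not> (\<exists>k'. ?F k' \<and> (norm (d k'))\<^sup>2 + 1 / Suc N < (norm (d k))\<^sup>2)"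
      obtain k' where k': "?F k'" "(norm (d k'))\<^sup>2 < (norm w)\<^sup>2 + e\<^sup>2 / 2"
        using dense[of "e\<^sup>2 / 2"] e(1) by auto
      have "(norm (d k))\<^sup>2 \<le> (norm (d k'))\<^sup>2 + 1 / Suc N"
        using no k'(1) by (meson not_less)
      then have "(norm (d k))\<^sup>2 < (norm w)\<^sup>2 + e\<^sup>2"
        using k'(2) N(2) by linarith
      then have "sim (d k) v < sim w v + r"
        using near[OF k] e by (simp add: abs_diff_less_iff)
      moreover have "t = sim w v + 2 * r"
        by (simp add: r_def field_simps)
      ultimately show "sim (d k) v \<le> t - 1 / Suc N"
        using N(1) by linarith
    qed
    then show "\<exists>N. \<forall>k. ?F k \<longrightarrow> ?G N k" by blast
  next
    assume "\<exists>N. \<forall>k. ?F k \<longrightarrow> ?G N k"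
    then obtain N where N: "\<And>k. ?F k \<Longrightarrow> ?G N k" by blast
    obtain e where e: "0 < e" "\<And>x. norm (x - w) < e \<Longrightarrow> \<bar>sim x v - sim w v\<bar> < 1 / Suc N"
      using cont[unfolded isCont_def LIM_eq, rule_format, of "1 / Suc N"]
      by (metis abs_zero diff_self real_norm_def of_nat_0_less_iff zero_less_Suc zero_less_divide_1_iff)
    \<comment> \<open>This \<open>d k\<close> is too close to optimal to be beaten by
      \<open>1 / Suc N\<close>, so the first alternative holds for it; continuity carries the bound
      over to \<open>w\<close>.\<close>
    obtain k where k: "?F k" "(norm (d k))\<^sup>2 < (norm w)\<^sup>2 + min (1 / Suc N) (e\<^sup>2)"
      using dense[of "min (1 / Suc N) (e\<^sup>2)"] e(1) by auto
    have "\<not> (norm (d k'))\<^sup>2 + 1 / Suc N < (norm (d k))\<^sup>2" if "?F k'" for k'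
    proof -
      have "norm w \<le> norm (d k')"
        using norm_max_margin_le[OF sep feas[OF that]] by (simp add: w_def)
      then have "(norm w)\<^sup>2 \<le> (norm (d k'))\<^sup>2"
        by (simp add: power_mono)
      then show ?thesis using k(2) by linarith
    qed
    then have "sim (d k) v \<le> t - 1 / Suc N"
      using N[OF k(1)] by blast
    moreover have "\<bar>sim (d k) v - sim w v\<bar> < 1 / Suc N"
      using near[OF k(1) _ e(1)] k(2) e(2) by simp
    ultimately show "sim (max_margin n S) v < t"
      unfolding w_def by linarith
  qed
qed

lemma linearly_separable_iff_dense:
  assumes n: "1 \<le> n" and d: "\<And>X. open X \<Longrightarrow> X \<noteq> {} \<Longrightarrow> \<exists>k::nat. d k \<in> X"
  shows "linearly_separable n S \<longleftrightarrow> (\<exists>k. \<forall>i\<in>{1..n}. 1 < d k \<bullet> signed_point (S i))"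
proof
  assume "linearly_separable n S"
  then show "\<exists>k. \<forall>i\<in>{1..n}. 1 < d k \<bullet> signed_point (S i)"
    using dense_strictly_feasible[OF _ n d zero_less_one] by blast
next
  assume "\<exists>k. \<forall>i\<in>{1..n}. 1 < d k \<bullet> signed_point (S i)"
  then show "linearly_separable n S"
    unfolding linearly_separable_iff by (meson less_trans zero_less_one)
qed

text \<open>Over a countable dense sequence the event becomes a formula with countable quantifiers,
  whose only dependence on the sample is through finitely many inner products.\<close>

lemma sets_sim_max_margin_less:
  fixes v :: "real ^ 'd"
  assumes n: "1 \<le> n" and v: "v \<noteq> 0" and M: "sets M = sets data_space"
  shows "{S \<in> space (Pi\<^sub>M {1..n} (\<lambda>_. M)). linearly_separable n S \<and> sim (max_margin n S) v < t}
    \<in> sets (Pi\<^sub>M {1..n} (\<lambda>_. M))"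
proof -
  note [measurable_cong] = M
  obtain D :: "(real ^ 'd) set" where D: "countable D" "\<And>X. open X \<Longrightarrow> X \<noteq> {} \<Longrightarrow> \<exists>x\<in>D. x \<in> X"
    using countable_dense_setE by blast
  define d where "d = from_nat_into D"
  have d: "\<exists>k. d k \<in> X" if "open X" "X \<noteq> {}" for X
    using D(2)[OF that] from_nat_into_surj[OF D(1)] by (metis d_def)
  have "(linearly_separable n S \<and> sim (max_margin n S) v < t) \<longleftrightarrow>
      (\<exists>k. \<forall>i\<in>{1..n}. 1 < d k \<bullet> signed_point (S i)) \<and>
      (\<exists>N::nat. \<forall>k. (\<forall>i\<in>{1..n}. 1 < d k \<bullet> signed_point (S i)) \<longrightarrow>
        sim (d k) v \<le> t - 1 / Suc N \<or>
        (\<exists>k'. (\<forall>i\<in>{1..n}. 1 < d k' \<bullet> signed_point (S i)) \<and>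
          (norm (d k'))\<^sup>2 + 1 / Suc N < (norm (d k))\<^sup>2))" for S
    using linearly_separable_iff_dense[OF n d] sim_max_margin_less_iff[OF _ n d v] by blast
  then show ?thesis
    by (simp only:) measurable
qed

text \<open>By Fubini: coordinate \<open>i\<close> is split off, and once the others are fixed it
  has to avoid a single value.\<close>

lemma AE_PiM_pair_neq:
  fixes f :: "'a \<Rightarrow> real"
  assumes M: "prob_space M" and f[measurable]: "f \<in> borel_measurable M"
    and ae: "\<And>c. AE x in M. f x \<noteq> c" and ij: "i \<in> I" "j \<in> I" "i \<noteq> j"
  shows "AE S in Pi\<^sub>M I (\<lambda>_. M). f (S i) \<noteq> f (S j)"
proof -
  interpret M: prob_space M by fact
  interpret J: prob_space "Pi\<^sub>M (I - {i}) (\<lambda>_. M)"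
    by (rule prob_space_PiM) (rule M)
  interpret pair_sigma_finite M "Pi\<^sub>M (I - {i}) (\<lambda>_. M)" ..
  have I: "I = insert i (I - {i})"
    using ij by auto
  have meas[measurable]: "(\<lambda>S. f (S i)) \<in> borel_measurable (Pi\<^sub>M I (\<lambda>_. M))"
    "(\<lambda>S. f (S j)) \<in> borel_measurable (Pi\<^sub>M I (\<lambda>_. M))"
    "(\<lambda>S. f (S j)) \<in> borel_measurable (Pi\<^sub>M (I - {i}) (\<lambda>_. M))"
    using ij by (auto intro!: measurable_compose[OF measurable_component_singleton, where g = f] f)
  \<comment> \<open>Exchanging the quantifiers makes \<open>f (X j)\<close> a constant for the inner
    one.\<close>
  have swap: "AE x in M. AE X in Pi\<^sub>M (I - {i}) (\<lambda>_. M). f x \<noteq> f (X j)"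
    by (subst AE_commute) (measurable, use ae in simp)
  have pair: "AE p in M \<Otimes>\<^sub>M Pi\<^sub>M (I - {i}) (\<lambda>_. M). f (fst p) \<noteq> f (snd p j)"
    by (rule AE_pair_measure) (measurable, use swap in simp)
  have distr: "Pi\<^sub>M I (\<lambda>_. M)
      = distr (M \<Otimes>\<^sub>M Pi\<^sub>M (I - {i}) (\<lambda>_. M)) (Pi\<^sub>M I (\<lambda>_. M)) (\<lambda>(x, X). X(i := x))"
    using distr_pair_PiM_eq_PiM[of "I - {i}" "\<lambda>_. M" i] M I by simp
  have upd: "(\<lambda>(x, X). X(i := x)) \<in> M \<Otimes>\<^sub>M Pi\<^sub>M (I - {i}) (\<lambda>_. M) \<rightarrow>\<^sub>M Pi\<^sub>M I (\<lambda>_. M)"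
    by (subst (2) I) measurable
  have "{S \<in> space (Pi\<^sub>M I (\<lambda>_. M)). f (S i) \<noteq> f (S j)} \<in> sets (Pi\<^sub>M I (\<lambda>_. M))"
    by (rule borel_measurable_neq[OF meas(1,2)])
  from AE_distr_iff[OF upd this] show ?thesis
    unfolding distr[symmetric] using pair ij by (simp add: case_prod_beta')
qed

section \<open>Concentration\<close>

text \<open>Independence turns the probability into an \<open>n\<close>-th power, which the
  Bernoulli inequality bounds from below.\<close>

lemma prob_PiM_all_ge:
  assumes M: "prob_space M" and G: "G \<in> sets M" and t: "1 - t \<le> measure M G"
  shows "1 - real n * t \<le> measure (Pi\<^sub>M {1..n} (\<lambda>_. M)) (Pi\<^sub>E {1..n} (\<lambda>_. G))"
proof -
  interpret M: prob_space M by fact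
  interpret finite_product_prob_space "\<lambda>_::nat. M" "{1..n}"
    by unfold_locales simp
  have "1 - real n * t \<le> 1 + real n * (measure M G - 1)"
    using mult_left_mono[OF t, of "real n"] by (simp add: algebra_simps)
  also have "\<dots> \<le> (1 + (measure M G - 1)) ^ n"
    by (rule Bernoulli_inequality) simp
  also have "\<dots> = prob (Pi\<^sub>E {1..n} (\<lambda>_. G))"
    using prob_times[of "\<lambda>_. G"] G by simp
  finally show ?thesis .
qed

section \<open>Choice of the constants and the high-probability event\<close>

theorem theorem3p7:
  fixes \<mu> :: "real ^ 'd" and \<Sigma> :: "real ^ 'd ^ 'd"
  assumes dim: "2 \<le> CARD('d)"
    and mu_nz: "\<mu> \<noteq> 0"
    and Sigma_pd: "pos_def \<Sigma>"
    and norm_eq: "(norm \<mu>)\<^sup>2 = spectral_norm \<Sigma>"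
  shows "\<exists>c>0. \<exists>\<kappa>0>0. \<forall>\<kappa>\<ge>\<kappa>0. \<forall>n::nat. 1 \<le> n \<and> real n \<le> exp (c * \<kappa>) \<longrightarrow>
    99 / 100 \<le> measure (iid_sample \<mu> \<Sigma> \<kappa> n)
      {S \<in> space (iid_sample \<mu> \<Sigma> \<kappa> n).
         linearly_separable n S \<and>
         sim (max_margin n S) (matrix_inv \<Sigma> *v \<mu>)
           < (1 + sim \<mu> (matrix_inv \<Sigma> *v \<mu>)) / 2}"
proof -
  define v where "v = matrix_inv \<Sigma> *v \<mu>"
  define s where "s = sim \<mu> v"
  have inv_pd: "pos_def (matrix_inv \<Sigma>)"
    using Sigma_pd by (rule pos_def_matrix_inv)
  then have v_pos: "0 < \<mu> \<bullet> v"
    using mu_nz by (simp add: pos_def_def v_def)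
  then have v: "v \<noteq> 0"
    by auto
  have s: "0 < s" "s \<le> 1"
    using v_pos v mu_nz sim_le_1[of \<mu> v] unfolding s_def by (simp_all add: sim_def)
  obtain l where l: "0 < l" "\<And>x. l * (norm x)\<^sup>2 \<le> x \<bullet> (matrix_inv \<Sigma> *v x)"
    using pos_def_lower_bound[OF inv_pd] by blast
  \<comment> \<open>For \<open>s < 1\<close> this makes \<open>4 * e / norm \<mu>\<close>, the bound
    on \<open>2 - 2 * sim w \<mu>\<close>, half of \<open>((1 - s) / 2)\<^sup>2\<close>. For
    \<open>s = 1\<close> only separability is needed, and any \<open>e\<close> below
    \<open>norm \<mu>\<close> serves.\<close>
  define e where "e = (if s < 1 then norm \<mu> * ((1 - s) / 2)\<^sup>2 / 8 else norm \<mu> / 2)"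
  have e: "0 < e" "e < norm \<mu>"
  proof -
    have "((1 - s) / 2)\<^sup>2 \<le> 1"
      using s by (intro power_le_one) auto
    then have "norm \<mu> * ((1 - s) / 2)\<^sup>2 \<le> norm \<mu> * 1"
      by (intro mult_left_mono) simp_all
    moreover have "0 < norm \<mu>"
      using mu_nz by simp
    ultimately show "0 < e" "e < norm \<mu>"
      by (auto simp: e_def)
  qed
  define C where "C = sqrt (2 ^ CARD('d))"
  have C: "1 \<le> C"
    by (simp add: C_def)
  \<comment> \<open>Half the rate of the Gaussian tail: one factor
    \<open>exp (- (c * \<kappa>))\<close> pays for \<open>n\<close>, the other absorbs
    \<open>C\<close>.\<close>
  define c where "c = l * e\<^sup>2 / 8"
  have c: "0 < c"
    using l e by (simp add: c_def)
  \<comment> \<open>The dimension hypothesis enters here; a nonzero product with \<open>a\<close>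
    certifies that a vector is not a multiple of \<mu>.\<close>
  obtain a where "a \<noteq> 0" "orthogonal \<mu> a"
    using orthogonal_to_vector_exists[of \<mu>] dim by auto
  then have a: "a \<noteq> 0" "a \<bullet> \<mu> = 0"
    by (simp_all add: orthogonal_def inner_commute)

  have "99 / 100 \<le> measure (iid_sample \<mu> \<Sigma> \<kappa> n) {S \<in> space (iid_sample \<mu> \<Sigma> \<kappa> n).
      linearly_separable n S \<and> sim (max_margin n S) v < (1 + s) / 2}"
    if \<kappa>: "ln (100 * C) / c \<le> \<kappa>" "1 \<le> \<kappa>" and n: "1 \<le> n" and n_le: "real n \<le> exp (c * \<kappa>)"
    for \<kappa> and n :: nat
  proof -
    have \<kappa>0: "0 < \<kappa>"
      using \<kappa> by simp
    define M where "M = mixture \<mu> \<Sigma> \<kappa>"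
    define P where "P = Pi\<^sub>M {1..n} (\<lambda>_. M)"
    have P: "iid_sample \<mu> \<Sigma> \<kappa> n = P"
      by (simp add: iid_sample_def P_def M_def)
    have sets_M[measurable_cong]: "sets M = sets data_space"
      unfolding M_def using Sigma_pd \<kappa>0 by (rule sets_mixture)
    have space_M: "space M = UNIV"
      using sets_eq_imp_space_eq[OF sets_M] by (simp add: space_pair_measure)
    have prob_M: "prob_space M"
      unfolding M_def using Sigma_pd \<kappa>0 by (rule prob_space_mixture)
    interpret M: prob_space M by (rule prob_M)
    interpret P: prob_space P
      unfolding P_def by (rule prob_space_PiM) (rule prob_M)
    define t where "t = C * exp (- (\<kappa> * l * e\<^sup>2 / 4))"
    define G where "G = {p. norm (signed_point p - \<mu>) \<le> e}"
    have G: "G \<in> sets M"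
      unfolding G_def sets_M using sets_signed_point[of "{x. norm (x - \<mu>) \<le> e}"] by simp
    have "emeasure M (space M - G) \<le> ennreal t"
    proof -
      have "space M - G = {p. e < norm (signed_point p - \<mu>)}"
        by (auto simp: G_def space_M)
      then show ?thesis
        using emeasure_mixture_tail[OF Sigma_pd \<kappa>0 l e(1)] by (simp add: M_def t_def C_def)
    qed
    then have "M.prob (space M - G) \<le> t"
      using C by (simp add: M.emeasure_eq_measure t_def)
    then have G_ge: "1 - t \<le> M.prob G"
      using M.prob_compl[OF G] by simp
    have "real n * t \<le> 1 / 100"
    proof -
      have "ln (100 * C) \<le> c * \<kappa>"
        using \<kappa>(1) c by (simp add: field_simps)
      then have "100 * C \<le> exp (c * \<kappa>)"
        using C by (metis exp_le_cancel_iff exp_ln less_le_trans mult_pos_pos zero_less_numeral zero_less_one)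
      then have "C * exp (- (c * \<kappa>)) \<le> 1 / 100"
        by (simp add: exp_minus field_simps)
      \<comment> \<open>The threshold on \<kappa> has bounded \<open>C\<close> times one factor by
        \<open>1 / 100\<close>; the bound on \<open>n\<close> takes the other.\<close>
      moreover have "t = C * exp (- (c * \<kappa>)) * exp (- (c * \<kappa>))"
        by (simp add: t_def c_def field_simps flip: exp_add)
      moreover have "real n * exp (- (c * \<kappa>)) \<le> 1"
        using n_le by (simp add: exp_minus field_simps)
      ultimately show ?thesis
        using mult_mono[of "C * exp (- (c * \<kappa>))" "1 / 100" "real n * exp (- (c * \<kappa>))" 1] C
        by (simp add: mult_ac)
    qed
    then have "99 / 100 \<le> P.prob (Pi\<^sub>E {1..n} (\<lambda>_. G))"
      using prob_PiM_all_ge[OF prob_M G G_ge, of n] by (simp add: P_def)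
    \<comment> \<open>The inclusion holds only up to a null set, since general position of the
      sample is an almost sure property.\<close>
    also have "\<dots> \<le> P.prob {S \<in> space P. linearly_separable n S \<and> sim (max_margin n S) v < (1 + s) / 2}"
    proof (rule P.finite_measure_mono_AE)
      show "{S \<in> space P. linearly_separable n S \<and> sim (max_margin n S) v < (1 + s) / 2} \<in> sets P"
        unfolding P_def using n v sets_M by (rule sets_sim_max_margin_less)
      have hyper: "AE p in M. b \<bullet> signed_point p \<noteq> r" if "b \<noteq> 0" for b r
        unfolding M_def using Sigma_pd \<kappa>0 that by (rule AE_mixture_hyperplane)
      have "AE S in P. \<forall>i\<in>{1..n}. a \<bullet> signed_point (S i) \<noteq> 0"
        unfolding P_def using prob_M hyper[OF a(1)]
        by (intro AE_finite_allI AE_PiM_component) auto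
      moreover have "AE S in P. \<forall>i\<in>{1..n}. \<forall>j\<in>{1..n}. i \<noteq> j \<longrightarrow>
          \<mu> \<bullet> signed_point (S i) \<noteq> \<mu> \<bullet> signed_point (S j)"
      proof (intro AE_finite_allI)
        fix i j assume ij: "i \<in> {1..n}" "j \<in> {1..n}"
        have "(\<lambda>p. \<mu> \<bullet> signed_point p) \<in> borel_measurable M"
          by measurable
        then show "AE S in P. i \<noteq> j \<longrightarrow> \<mu> \<bullet> signed_point (S i) \<noteq> \<mu> \<bullet> signed_point (S j)"
          using AE_PiM_pair_neq[OF prob_M _ hyper[OF mu_nz] ij] unfolding P_def by (cases "i = j") auto
      qed simp_all
      ultimately show "AE S in P. S \<in> Pi\<^sub>E {1..n} (\<lambda>_. G) \<longrightarrow>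
          S \<in> {S \<in> space P. linearly_separable n S \<and> sim (max_margin n S) v < (1 + s) / 2}"
        using AE_space
      proof eventually_elim
        case (elim S)
        show ?case
        proof
          assume "S \<in> Pi\<^sub>E {1..n} (\<lambda>_. G)"
          then have near: "norm (signed_point (S i) - \<mu>) \<le> e" if "i \<in> {1..n}" for i
            using that by (auto simp: G_def PiE_iff)
          have sep: "linearly_separable n S"
            by (rule near_mean_feasible(1)[OF mu_nz e(2) near])
          define w where "w = max_margin n S"
          have w: "w \<noteq> 0"
            using max_margin_nonzero[OF sep n] by (simp add: w_def)
          have "sim w v < (1 + s) / 2"
          proof (cases "s < 1")
            case True
            have "1 - 2 * e / norm \<mu> \<le> sim w \<mu>"
              unfolding w_def using n mu_nz less_imp_le[OF e(1)] e(2) near by (rule sim_max_margin_mean_ge)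
            moreover have "e / norm \<mu> = ((1 - s) / 2)\<^sup>2 / 8"
              using mu_nz True by (simp add: e_def)
            moreover have "0 < ((1 - s) / 2)\<^sup>2"
              using True by simp
            ultimately have "2 - 2 * sim w \<mu> < ((1 - s) / 2)\<^sup>2"
              by linarith
            \<comment> \<open>The similarity to \<open>v\<close> thus exceeds \<open>s\<close> by
              less than half the gap to one, which is the required bound.\<close>
            then have "sqrt (2 - 2 * sim w \<mu>) < (1 - s) / 2"
              using True by (intro real_less_lsqrt) auto
            then show ?thesis
              using sim_le_sim_add[OF mu_nz v w] by (simp add: s_def field_simps)
          next
            case False
            \<comment> \<open>Now the required bound is one, so only equality in Cauchy-Schwarz has
              to be excluded; since \<open>v\<close> is parallel to \<mu>, equality would make
              \<open>w\<close> a multiple of \<mu>.\<close>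
            then have "s = 1" using s by simp
            then have \<mu>v: "norm \<mu> *\<^sub>R v = norm v *\<^sub>R \<mu>"
              using sim_eq_1_iff[OF mu_nz v] by (simp add: s_def)
            have "sim w v \<noteq> 1"
            proof
              assume "sim w v = 1"
              then have "norm w *\<^sub>R v = norm v *\<^sub>R w"
                using sim_eq_1_iff[OF w v] by simp
              then have "norm v *\<^sub>R (norm \<mu> *\<^sub>R w) = norm v *\<^sub>R (norm w *\<^sub>R \<mu>)"
                by (metis \<mu>v scaleR_left_commute)
              then have "norm \<mu> *\<^sub>R w = norm w *\<^sub>R \<mu>"
                using v by (metis norm_eq_zero scaleR_cancel_left)
              then have "w = (norm w / norm \<mu>) *\<^sub>R \<mu>"
                using mu_nz by (simp add: eq_vector_fraction_iff)
              moreover have "max_margin n S \<noteq> (norm w / norm \<mu>) *\<^sub>R \<mu>"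
                by (rule max_margin_not_parallel[OF sep n a(2)]) (use elim in auto)
              ultimately show False
                by (simp add: w_def)
            qed
            then show ?thesis
              using sim_le_1[of w v] \<open>s = 1\<close> by simp
          qed
          then show "S \<in> {S \<in> space P. linearly_separable n S \<and> sim (max_margin n S) v < (1 + s) / 2}"
            using sep elim by (simp add: w_def)
        qed
      qed
    qed
    finally show ?thesis
      by (simp add: P)
  qed
  note main = this
  show ?thesis
    unfolding v_def[symmetric] s_def[symmetric]
  proof (intro exI conjI allI impI)
    show "0 < c" by (rule c)
    show "0 < max 1 (ln (100 * C) / c)" by simp
  qed (intro main; simp)
qed

end
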